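(* Let $D\subset\mathbb{C}$ be an open simply connected domain, $N\ge 1$, and let $A$ be an $(N\times N)$-matrix function on $D$. Let $F$ be a solution on $D$ of $$\partial_{\bar z}F + AF = 0,$$ let $F^+$ be an $(N\times N)$-matrix function on $D$, let $\hat\omega_{F,F^+}$ be an $(N\times N)$-matrix function on $D$ with $$\partial_{\bar z}\,\hat\omega_{F,F^+} = F^+F,\qquad \det\hat\omega_{F,F^+}\neq 0 \text{ everywhere on } D,$$ and put $$\tilde A = A + F\,\hat\omega_{F,F^+}^{-1}\,F^+ .$$ Let $\Lambda$ be an $(N\times N)$-matrix function on $D$ satisfying $$\partial_{\bar z}\Lambda = \Lambda A + F^+,$$ and let $$g = 1 - F\,\hat\omega_{F,F^+}^{-1}\,\Lambda ,$$ where $1$ is the identity matrix. Then for every $(N\times N)$-matrix solution $\Psi$ of $\partial_{\bar z}\Psi + A\Psi = 0$ on $D$, $$\partial_{\bar z}(g\Psi) + \tilde A\,(g\Psi) = 0 .$$ Moreover, if $g$ is invertible everywhere on $D$, then the transformation $A\to\tilde A$ is the gauge transformation by $g$, i.e. $$\tilde A = gAg^{-1} - (\partial_{\bar z}g)\,g^{-1}.$$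
   Context: All matrix functions take values in complex $(N\times N)$-matrices; $z=x+iy$ is the coordinate on $D$ and $\partial_{\bar z}=\frac12(\partial_x+i\partial_y)$ acts entrywise. Functions that are differentiated are assumed to be differentiable (in the real sense) and the equations hold pointwise on $D$. The gauge transformation of the connection $\nabla_{\bar z}=\partial_{\bar z}+A$ by an invertible matrix function $g$ is $\Psi\to g\Psi$, $\partial_{\bar z}+A \to g\,(\partial_{\bar z}+A)\,g^{-1} = \partial_{\bar z} + gAg^{-1} - (\partial_{\bar z}g)g^{-1}$. *)

theory Defs
  imports "HOL-Analysis.Analysis"
begin

definition dbar :: "(complex \<Rightarrow> complex) \<Rightarrow> complex \<Rightarrow> complex" where
  "dbar f z =
     (vector_derivative (\<lambda>x. f (Complex x (Im z))) (at (Re z))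
      + \<i> * vector_derivative (\<lambda>y. f (Complex (Re z) y)) (at (Im z))) / 2"

definition mdbar :: "(complex \<Rightarrow> complex^'n^'n) \<Rightarrow> complex \<Rightarrow> complex^'n^'n" where
  "mdbar M z = (\<chi> i j. dbar (\<lambda>w. M w $ i $ j) z)"

(* Since dbar is total, differentiability (in the real sense: differentiable_on is the real
   Frechet notion) has to be part of the notion of a solution. *)
definition dbar_solution ::
    "complex set \<Rightarrow> (complex \<Rightarrow> complex^'n^'n) \<Rightarrow> (complex \<Rightarrow> complex^'n^'n) \<Rightarrow> bool" where
  "dbar_solution D A M \<longleftrightarrow>
     M differentiable_on D \<and> (\<forall>z\<in>D. mdbar M z + A z ** M z = 0)"

(* The potential of the connection g (dbar + A) g^(-1). *)
definition gauge_transform ::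
    "(complex \<Rightarrow> complex^'n^'n) \<Rightarrow> (complex \<Rightarrow> complex^'n^'n) \<Rightarrow> complex \<Rightarrow> complex^'n^'n" where
  "gauge_transform g A z =
     g z ** A z ** matrix_inv (g z) - mdbar g z ** matrix_inv (g z)"

end

theory Submission
  imports Defs
begin

text \<open>
  Why the theorem holds. Write \<open>dbar\<close> also for \<open>mdbar\<close>. It is a derivation on matrix functions
  (\<open>mdbar_mult\<close>), so differentiating \<open>\<omega> \<omega>\<^sup>-\<^sup>1 = 1\<close> gives \<open>dbar (\<omega>\<^sup>-\<^sup>1) = - \<omega>\<^sup>-\<^sup>1 F\<^sup>+ F \<omega>\<^sup>-\<^sup>1\<close>. The
  equations for \<open>F\<close> and \<open>\<Lambda>\<close> then turn the Leibniz rule for \<open>g = 1 - F \<omega>\<^sup>-\<^sup>1 \<Lambda>\<close> into the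
  intertwining relation \<open>dbar g = g A - A' g\<close> (\<open>mdbar_intertwiner\<close>), with \<open>A' = A + F \<omega>\<^sup>-\<^sup>1 F\<^sup>+\<close>.
  Equivalently, \<open>g (dbar + A) = (dbar + A') g\<close> as operators on differentiable matrix functions.
  Applying this to a solution \<open>\<Psi>\<close> shows that \<open>g \<Psi>\<close> solves the transformed equation, whether or
  not \<open>g\<close> is invertible; multiplying the relation by \<open>g\<^sup>-\<^sup>1\<close> on the right, where that is possible,
  shows that \<open>A'\<close> is the gauge transform of \<open>A\<close>.

  The analytic content is that \<open>\<omega>\<^sup>-\<^sup>1\<close> and \<open>g\<close> are real differentiable, so that the pointwise
  partial derivatives in \<open>dbar\<close> obey the Leibniz rule. For \<open>\<omega>\<^sup>-\<^sup>1\<close> this follows from Cramer's rule: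
  its entries are quotients of determinants in the entries of \<open>\<omega>\<close> (\<open>differentiable_matrix_inv\<close>).
\<close>

section \<open>Differentiability of matrix products and inverses\<close>

lemma bounded_bilinear_matrix_mult:
  "bounded_bilinear ((**) :: complex^'n^'n \<Rightarrow> complex^'n^'n \<Rightarrow> complex^'n^'n)"
  unfolding bilinear_conv_bounded_bilinear [symmetric] bilinear_def
  by (auto intro!: linearI simp: matrix_add_ldistrib matrix_matrix_mult_def vec_eq_iff
      sum.distrib scaleR_sum_right algebra_simps)

lemma has_derivative_matrix_mult:
  fixes M K :: "complex \<Rightarrow> complex^'n^'n"
  assumes "(M has_derivative M') (at z)" and "(K has_derivative K') (at z)"
  shows "((\<lambda>w. M w ** K w) has_derivative (\<lambda>h. M z ** K' h + M' h ** K z)) (at z)"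
  by (rule bounded_bilinear.FDERIV [OF bounded_bilinear_matrix_mult assms])

lemma differentiable_matrix_mult:
  fixes M K :: "complex \<Rightarrow> complex^'n^'n"
  assumes "M differentiable at z" and "K differentiable at z"
  shows "(\<lambda>w. M w ** K w) differentiable at z"
  using assms has_derivative_matrix_mult unfolding differentiable_def by blast

lemma has_derivative_matrix_entry:
  fixes M :: "complex \<Rightarrow> complex^'n^'n"
  assumes "(M has_derivative M') (at z)"
  shows "((\<lambda>w. M w $ i $ j) has_derivative (\<lambda>h. M' h $ i $ j)) (at z)"
  by (intro bounded_linear.has_derivative [OF bounded_linear_vec_nth] assms)

lemma differentiable_matrix_iff:
  fixes M :: "complex \<Rightarrow> complex^'n^'n"
  shows "M differentiable at z \<longleftrightarrow> (\<forall>i j. (\<lambda>w. M w $ i $ j) differentiable at z)"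
proof
  assume "M differentiable at z"
  then obtain M' where "(M has_derivative M') (at z)"
    by (auto simp: differentiable_def)
  from differentiableI [OF has_derivative_matrix_entry [OF this]]
  show "\<forall>i j. (\<lambda>w. M w $ i $ j) differentiable at z"
    by blast
next
  assume "\<forall>i j. (\<lambda>w. M w $ i $ j) differentiable at z"
  then have "(\<lambda>w. M w $ i $ j \<bullet> c) differentiable at z" for i j c
    by (intro differentiable_inner differentiable_const) auto
  then show "M differentiable at z"
    by (subst differentiable_componentwise_within) (auto simp: Basis_vec_def inner_axis)
qed

lemma differentiable_det:
  fixes M :: "complex \<Rightarrow> complex^'n^'n"
  assumes "M differentiable at z"
  shows "(\<lambda>w. det (M w)) differentiable at z"
proof -
  have "((\<lambda>w. M w $ i $ j) has_derivative frechet_derivative (\<lambda>w. M w $ i $ j) (at z)) (at z)" for i j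
    using assms by (simp add: differentiable_matrix_iff flip: frechet_derivative_works)
  then have "(\<lambda>w. \<Prod>i\<in>UNIV. M w $ i $ p i) differentiable at z" for p :: "'n \<Rightarrow> 'n"
    by (rule differentiableI [OF has_derivative_prod])
  then show ?thesis
    unfolding det_def by (intro differentiable_sum differentiable_mult) (auto simp: finite_permutations)
qed

lemma matrix_inv_mult:
  fixes M :: "complex^'n^'n"
  assumes "invertible M"
  shows "M ** matrix_inv M = mat 1" and "matrix_inv M ** M = mat 1"
  using someI_ex [OF assms [unfolded invertible_def]] by (simp_all add: matrix_inv_def)

text \<open>Column \<open>l\<close> of the inverse solves the linear system whose right-hand side is the \<open>l\<close>-th unit
  vector, so Cramer's rule expresses its entries by determinants.\<close>

lemma matrix_inv_cramer:
  fixes M :: "complex^'n^'n"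
  assumes "det M \<noteq> 0"
  shows "matrix_inv M $ k $ l =
    det (\<chi> i j. if j = k then mat 1 $ i $ l else M $ i $ j) / det M"
proof -
  have "M ** matrix_inv M = mat 1"
    using assms by (simp add: invertible_det_nz matrix_inv_mult(1))
  then have "M *v column l (matrix_inv M) = column l (mat 1)"
    by (simp add: vec_eq_iff column_def matrix_vector_mult_def matrix_matrix_mult_def)
  then have "column l (matrix_inv M) =
      (\<chi> k. det (\<chi> i j. if j = k then column l (mat 1) $ i else M $ i $ j) / det M)"
    using cramer [OF assms] by blast
  then show ?thesis
    by (simp add: vec_eq_iff column_def cong: if_cong)
qed

text \<open>Cramer's quotient formula holds on the whole neighbourhood \<open>D\<close> of \<open>z\<close>, and determinants are
  polynomials in the entries, so the formula may be differentiated at \<open>z\<close>.\<close>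

lemma differentiable_matrix_inv:
  fixes M :: "complex \<Rightarrow> complex^'n^'n"
  assumes M: "M differentiable at z" and "open D" "z \<in> D"
    and nz: "\<And>w. w \<in> D \<Longrightarrow> det (M w) \<noteq> 0"
  shows "(\<lambda>w. matrix_inv (M w)) differentiable at z"
  unfolding differentiable_matrix_iff
proof (intro allI)
  fix k l
  define R where "R w = (\<chi> i j. if j = k then mat 1 $ i $ l else M w $ i $ j)" for w
  have "R differentiable at z"
    unfolding differentiable_matrix_iff
  proof (intro allI)
    fix i j
    show "(\<lambda>w. R w $ i $ j) differentiable at z"
      using M by (cases "j = k") (auto simp: differentiable_matrix_iff R_def)
  qed
  then have "(\<lambda>w. det (R w) / det (M w)) differentiable at z"
    using nz \<open>z \<in> D\<close> M by (intro differentiable_divide differentiable_det) auto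
  then obtain f where f: "((\<lambda>w. det (R w) / det (M w)) has_derivative f) (at z)"
    unfolding differentiable_def by blast
  have "((\<lambda>w. matrix_inv (M w) $ k $ l) has_derivative f) (at z)"
    using f \<open>open D\<close> \<open>z \<in> D\<close>
    by (rule has_derivative_transform_within_open) (simp add: matrix_inv_cramer nz R_def)
  then show "(\<lambda>w. matrix_inv (M w) $ k $ l) differentiable at z"
    unfolding differentiable_def by blast
qed

section \<open>The operator dbar as a derivation\<close>

lemma dbar_eq_derivative:
  assumes "(f has_derivative f') (at z)"
  shows "dbar f z = (f' 1 + \<i> * f' \<i>) / 2"
proof -
  have x: "((\<lambda>x. Complex x (Im z)) has_derivative (\<lambda>t. t *\<^sub>R 1)) (at (Re z))"
    unfolding Complex_eq by (auto intro!: derivative_eq_intros simp: scaleR_conv_of_real)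
  have y: "((\<lambda>y. Complex (Re z) y) has_derivative (\<lambda>t. t *\<^sub>R \<i>)) (at (Im z))"
    unfolding Complex_eq by (auto intro!: derivative_eq_intros simp: scaleR_conv_of_real)
  have "((\<lambda>x. f (Complex x (Im z))) has_derivative (\<lambda>t. f' (t *\<^sub>R 1))) (at (Re z))"
    by (rule has_derivative_compose [OF x]) (simp add: assms)
  moreover have "((\<lambda>y. f (Complex (Re z) y)) has_derivative (\<lambda>t. f' (t *\<^sub>R \<i>))) (at (Im z))"
    by (rule has_derivative_compose [OF y]) (simp add: assms)
  moreover have "f' (t *\<^sub>R h) = t *\<^sub>R f' h" for t h
    by (rule linear_simps(5) [OF has_derivative_bounded_linear [OF assms]])
  ultimately show ?thesis
    unfolding dbar_def
    by (auto simp: has_vector_derivative_def vector_derivative_at)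
qed

lemma mdbar_eq_derivative:
  assumes "(M has_derivative M') (at z)"
  shows "mdbar M z = (\<chi> i j. (M' 1 $ i $ j + \<i> * M' \<i> $ i $ j) / 2)"
  by (simp add: mdbar_def dbar_eq_derivative [OF has_derivative_matrix_entry [OF assms]])

lemma mdbar_mult:
  fixes M K :: "complex \<Rightarrow> complex^'n^'n"
  assumes "M differentiable at z" and "K differentiable at z"
  shows "mdbar (\<lambda>w. M w ** K w) z = mdbar M z ** K z + M z ** mdbar K z"
proof -
  obtain M' K' where M': "(M has_derivative M') (at z)" and K': "(K has_derivative K') (at z)"
    using assms unfolding differentiable_def by blast
  show ?thesis
    unfolding mdbar_eq_derivative [OF M'] mdbar_eq_derivative [OF K']
      mdbar_eq_derivative [OF has_derivative_matrix_mult [OF M' K']]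
    unfolding vec_eq_iff matrix_matrix_mult_def
    by (auto simp: sum_distrib_left sum_divide_distrib sum.distrib [symmetric] field_simps
        intro!: sum.cong simp del: sum.distrib)
qed

lemma mdbar_const_diff:
  assumes "M differentiable at z"
  shows "mdbar (\<lambda>w. C - M w) z = - mdbar M z"
proof -
  obtain M' where M': "(M has_derivative M') (at z)"
    using assms unfolding differentiable_def by blast
  have "((\<lambda>w. C - M w) has_derivative (\<lambda>h. - M' h)) (at z)"
    by (auto intro!: derivative_eq_intros M')
  from mdbar_eq_derivative [OF this] show ?thesis
    by (simp add: mdbar_eq_derivative [OF M'] vec_eq_iff field_simps)
qed

lemma mdbar_const: "mdbar (\<lambda>w. C) z = 0"
  by (simp add: mdbar_eq_derivative [OF has_derivative_const] vec_eq_iff)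

text \<open>The identity \<open>\<omega> \<omega>\<^sup>-\<^sup>1 = 1\<close> and the formula for \<open>g\<close> hold only on \<open>D\<close>. Since \<open>D\<close> is open, they
  may still be differentiated at its points.\<close>

lemma mdbar_cong_open:
  assumes "open D" "z \<in> D" and eq: "\<And>w. w \<in> D \<Longrightarrow> M w = K w"
    and "M differentiable at z"
  shows "K differentiable at z" and "mdbar K z = mdbar M z"
proof -
  obtain M' where M': "(M has_derivative M') (at z)"
    using assms unfolding differentiable_def by blast
  then have K': "(K has_derivative M') (at z)"
    using assms(1,2) by (rule has_derivative_transform_within_open) (rule eq)
  show "K differentiable at z"
    using K' unfolding differentiable_def by blast
  show "mdbar K z = mdbar M z"
    unfolding mdbar_eq_derivative [OF M'] mdbar_eq_derivative [OF K'] ..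
qed

lemma matrix_add_mult_left: "(X + Y) ** Z = X ** Z + Y ** Z" for X Y Z :: "complex^'n^'n"
  by (rule bounded_bilinear.add_left [OF bounded_bilinear_matrix_mult])

lemma matrix_minus_mult_left: "(- X) ** Y = - (X ** Y)" for X Y :: "complex^'n^'n"
  by (rule bounded_bilinear.minus_left [OF bounded_bilinear_matrix_mult])

lemma matrix_minus_mult_right: "X ** (- Y) = - (X ** Y)" for X Y :: "complex^'n^'n"
  by (rule bounded_bilinear.minus_right [OF bounded_bilinear_matrix_mult])

lemma matrix_diff_mult_left: "(X - Y) ** Z = X ** Z - Y ** Z" for X Y Z :: "complex^'n^'n"
  by (rule bounded_bilinear.diff_left [OF bounded_bilinear_matrix_mult])

lemma matrix_diff_mult_right: "X ** (Y - Z) = X ** Y - X ** Z" for X Y Z :: "complex^'n^'n"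
  by (rule bounded_bilinear.diff_right [OF bounded_bilinear_matrix_mult])

lemmas matrix_ring_simps =
  matrix_minus_mult_left matrix_minus_mult_right matrix_diff_mult_left matrix_diff_mult_right
  matrix_add_ldistrib matrix_add_mult_left matrix_mul_assoc

text \<open>Differentiate \<open>M M\<^sup>-\<^sup>1 = 1\<close> and solve for the derivative of the second factor.\<close>

lemma mdbar_matrix_inv:
  fixes M :: "complex \<Rightarrow> complex^'n^'n"
  assumes M: "M differentiable at z" and D: "open D" "z \<in> D"
    and nz: "\<And>w. w \<in> D \<Longrightarrow> det (M w) \<noteq> 0"
  shows "mdbar (\<lambda>w. matrix_inv (M w)) z = - (matrix_inv (M z) ** mdbar M z ** matrix_inv (M z))"
proof -
  let ?W = "\<lambda>w. matrix_inv (M w)"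
  have W: "?W differentiable at z"
    by (rule differentiable_matrix_inv [OF M D nz])
  have "mdbar (\<lambda>w. M w ** ?W w) z = mdbar (\<lambda>w. mat 1) z"
    by (rule mdbar_cong_open(2) [OF D]) (simp_all add: nz invertible_det_nz matrix_inv_mult(1))
  then have 0: "mdbar M z ** ?W z + M z ** mdbar ?W z = 0"
    by (simp add: mdbar_mult [OF M W] mdbar_const)
  have "?W z ** M z = mat 1"
    using nz D by (simp add: invertible_det_nz matrix_inv_mult(2))
  then have "?W z ** (mdbar M z ** ?W z + M z ** mdbar ?W z) =
      ?W z ** mdbar M z ** ?W z + mdbar ?W z"
    by (simp add: matrix_add_ldistrib matrix_mul_assoc)
  then show ?thesis
    unfolding 0 by (simp add: eq_neg_iff_add_eq_0 add.commute)
qed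

section \<open>The intertwining relation and the gauge transformation\<close>

text \<open>Write \<open>F\<^sup>+\<close> for \<open>B\<close>. In \<open>mdbar g\<close> the summand \<open>A F \<omega>\<^sup>-\<^sup>1 \<Lambda>\<close> comes from the equation for \<open>F\<close>, the summand
  \<open>F \<omega>\<^sup>-\<^sup>1 F\<^sup>+ F \<omega>\<^sup>-\<^sup>1 \<Lambda>\<close> from the inverse, and \<open>- F \<omega>\<^sup>-\<^sup>1 (\<Lambda> A + F\<^sup>+)\<close> from the equation for \<open>\<Lambda>\<close>; with
  \<open>F \<omega>\<^sup>-\<^sup>1 \<Lambda> = 1 - g\<close> they regroup into \<open>g A - (A + F \<omega>\<^sup>-\<^sup>1 F\<^sup>+) g\<close>.\<close>

lemma mdbar_intertwiner:
  fixes F \<omega> \<Lambda> g :: "complex \<Rightarrow> complex^'n^'n" and A B :: "complex^'n^'n"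
  assumes D: "open D" "z \<in> D"
    and F: "F differentiable at z" "mdbar F z = - (A ** F z)"
    and om: "\<omega> differentiable at z" "mdbar \<omega> z = B ** F z" "\<And>w. w \<in> D \<Longrightarrow> det (\<omega> w) \<noteq> 0"
    and L: "\<Lambda> differentiable at z" "mdbar \<Lambda> z = \<Lambda> z ** A + B"
    and g: "\<And>w. w \<in> D \<Longrightarrow> g w = mat 1 - F w ** matrix_inv (\<omega> w) ** \<Lambda> w"
  shows "g differentiable at z"
    and "mdbar g z = g z ** A - (A + F z ** matrix_inv (\<omega> z) ** B) ** g z"
proof -
  let ?W = "\<lambda>w. matrix_inv (\<omega> w)"
  let ?G = "\<lambda>w. F w ** ?W w ** \<Lambda> w"
  have W: "?W differentiable at z"
    by (rule differentiable_matrix_inv [OF om(1) D om(3)])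
  note FW = differentiable_matrix_mult [OF F(1) W]
  note G = differentiable_matrix_mult [OF FW L(1)]
  have G1: "(\<lambda>w. mat 1 - ?G w) differentiable at z"
    by (intro differentiable_diff differentiable_const G)
  show "g differentiable at z"
    by (rule mdbar_cong_open(1) [OF D _ G1]) (simp add: g)
  have "mdbar g z = mdbar (\<lambda>w. mat 1 - ?G w) z"
    by (rule mdbar_cong_open(2) [OF D _ G1]) (simp add: g)
  also have "\<dots> = - mdbar ?G z"
    by (rule mdbar_const_diff [OF G])
  also have "\<dots> = g z ** A - (A + F z ** ?W z ** B) ** g z"
    by (simp add: mdbar_mult [OF FW L(1)] mdbar_mult [OF F(1) W]
        mdbar_matrix_inv [OF om(1) D om(3)] F(2) om(2) L(2) g [OF D(2)] matrix_ring_simps)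
  finally show "mdbar g z = g z ** A - (A + F z ** ?W z ** B) ** g z" .
qed

theorem mainTheorem3:
  fixes D :: "complex set"
    and A F F_plus \<omega> A_tilde \<Lambda> g :: "complex \<Rightarrow> complex^'n^'n"
  assumes "open D" and "D \<noteq> {}" and "simply_connected D"
    and "dbar_solution D A F"
    and "\<omega> differentiable_on D"
    and "\<And>z. z \<in> D \<Longrightarrow> mdbar \<omega> z = F_plus z ** F z"
    and "\<And>z. z \<in> D \<Longrightarrow> det (\<omega> z) \<noteq> 0"
    and "\<And>z. z \<in> D \<Longrightarrow> A_tilde z = A z + F z ** matrix_inv (\<omega> z) ** F_plus z"
    and "\<Lambda> differentiable_on D"
    and "\<And>z. z \<in> D \<Longrightarrow> mdbar \<Lambda> z = \<Lambda> z ** A z + F_plus z"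
    and "\<And>z. z \<in> D \<Longrightarrow> g z = mat 1 - F z ** matrix_inv (\<omega> z) ** \<Lambda> z"
  shows "(\<forall>\<Psi>. dbar_solution D A \<Psi> \<longrightarrow> dbar_solution D A_tilde (\<lambda>z. g z ** \<Psi> z)) \<and>
         ((\<forall>z\<in>D. invertible (g z)) \<longrightarrow>
           g differentiable_on D \<and> (\<forall>z\<in>D. A_tilde z = gauge_transform g A z))"
proof -
  note om_nz = assms(7) and g_eq = assms(11)
  have at: "M differentiable at z" if "M differentiable_on D" "z \<in> D"
    for M :: "complex \<Rightarrow> complex^'n^'n" and z
    using that \<open>open D\<close> by (simp add: differentiable_on_eq_differentiable_at)
  have F: "F differentiable_on D" "\<And>z. z \<in> D \<Longrightarrow> mdbar F z = - (A z ** F z)"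
    using assms(4) by (auto simp: dbar_solution_def eq_neg_iff_add_eq_0)
  have g_diff: "g differentiable at z"
    and g_bar: "mdbar g z = g z ** A z - A_tilde z ** g z" if "z \<in> D" for z
    using mdbar_intertwiner [OF \<open>open D\<close> that at [OF F(1) that] F(2) [OF that]
        at [OF assms(5) that] assms(6) [OF that] om_nz at [OF assms(9) that] assms(10) [OF that] g_eq]
    by (simp_all add: assms(8) [OF that])
  have "dbar_solution D A_tilde (\<lambda>z. g z ** \<Psi> z)" if "dbar_solution D A \<Psi>" for \<Psi>
    unfolding dbar_solution_def
  proof (intro conjI ballI)
    have \<Psi>: "\<Psi> differentiable at z" "mdbar \<Psi> z = - (A z ** \<Psi> z)" if "z \<in> D" for z
      using \<open>dbar_solution D A \<Psi>\<close> that at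
      by (auto simp: dbar_solution_def eq_neg_iff_add_eq_0)
    show "(\<lambda>z. g z ** \<Psi> z) differentiable_on D"
      using g_diff \<Psi>(1) \<open>open D\<close>
      by (auto simp: differentiable_on_eq_differentiable_at intro: differentiable_matrix_mult)
    show "mdbar (\<lambda>z. g z ** \<Psi> z) z + A_tilde z ** (g z ** \<Psi> z) = 0" if "z \<in> D" for z
      using that by (simp add: mdbar_mult g_diff g_bar \<Psi> matrix_ring_simps)
  qed
  moreover have "g differentiable_on D"
    using g_diff \<open>open D\<close> by (simp add: differentiable_on_eq_differentiable_at)
  moreover have "A_tilde z = gauge_transform g A z" if "z \<in> D" "invertible (g z)" for z
  proof -
    have "A_tilde z ** g z ** matrix_inv (g z) = A_tilde z"
      using that(2) by (simp add: matrix_inv_mult(1) flip: matrix_mul_assoc)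
    then show ?thesis
      by (simp add: gauge_transform_def g_bar [OF that(1)] matrix_diff_mult_left)
  qed
  ultimately show ?thesis
    by blast
qed

end
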